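(* For each $p$, $1\le p\le\infty$, the test functions satisfy $\mathcal{D}\subset KS^p(\mathbb{R}^n)$ as a continuous embedding.
   Context: $\mathcal{D}=\mathcal{D}[\mathbb{R}^n]$ is the space of test functions $C_c^\infty(\mathbb{R}^n)$ with its standard locally convex topology: $\phi_j\to\phi$ in $\mathcal{D}$ means there is a compact set containing the supports of all $\phi_j-\phi$ on which $D^\alpha\phi_j\to D^\alpha\phi$ uniformly for every multi-index $\alpha$. $\lambda_n$ is Lebesgue measure on $\mathbb{R}^n$. Enumerate the rational points as $\mathbb{Q}^n=\{\mathbf{x}_1,\mathbf{x}_2,\dots\}$. For $l,i\in\mathbb{N}$ let $\mathbf{B}_l(\mathbf{x}_i)$ be the closed cube centered at $\mathbf{x}_i$ with sides parallel to the coordinate axes and edge $e_l=\frac{1}{2^l\sqrt n}$. Using the natural bijection $\mathbb{N}\times\mathbb{N}\to\mathbb{N}$, list all these cubes as $\{\mathbf{B}_k:k\in\mathbb{N}\}$, and let $\mathcal{E}_k$ be the characteristic function of $\mathbf{B}_k$. Fix $t_k>0$ with $\sum_{k=1}^\infty t_k=1$. For $f\in L^p[\mathbb{R}^n]$ set $$\|f\|_{KS^p}=\Big\{\sum_{k=1}^\infty t_k\Big|\int_{\mathbb{R}^n}\mathcal{E}_k f\,d\lambda_n\Big|^p\Big\}^{1/p}\ (1\le p<\infty),\qquad \|f\|_{KS^\infty}=\sup_{k\ge1}\Big|\int_{\mathbb{R}^n}\mathcal{E}_k f\,d\lambda_n\Big|.$$ $KS^p(\mathbb{R}^n)$ is the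 completion of $L^p[\mathbb{R}^n]$ with respect to this norm. *)

theory Defs
  imports "HOL-Analysis.Analysis" "HOL-Library.Nat_Bijection"
begin

text \<open>
  The scalars range over a type \<open>'k\<close> of sort \<open>{real_normed_field, euclidean_space}\<close>, i.e.
  a finite-dimensional normed field over the reals. Up to isometric isomorphism this is exactly
  the real or the complex numbers, so the development covers both choices of scalars.
  All index sets of the form 1, 2, 3, ... are shifted to start at 0.
\<close>

section \<open>Test functions\<close>

definition partial_deriv :: "'n \<Rightarrow> (real^'n \<Rightarrow> 'k) \<Rightarrow> real^'n \<Rightarrow> 'k::{real_normed_field, euclidean_space}" where
  "partial_deriv i f y = vector_derivative (\<lambda>h. f (y + h *\<^sub>R axis i 1)) (at 0)"

text \<open>
  Multi-indices are written as finite lists of coordinate directions, since the index type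
  carries no order; on smooth functions the order of the list is immaterial.
\<close>

primrec mderiv :: "'n list \<Rightarrow> (real^'n \<Rightarrow> 'k) \<Rightarrow> real^'n \<Rightarrow> 'k::{real_normed_field, euclidean_space}" where
  "mderiv [] f = f"
| "mderiv (i # \<alpha>) f = partial_deriv i (mderiv \<alpha> f)"

definition smooth :: "(real^'n \<Rightarrow> 'k::{real_normed_field, euclidean_space}) \<Rightarrow> bool" where
  "smooth f \<longleftrightarrow> (\<forall>\<alpha>. continuous_on UNIV (mderiv \<alpha> f) \<and>
     (\<forall>i y. (\<lambda>h. mderiv \<alpha> f (y + h *\<^sub>R axis i 1)) differentiable (at (0::real))))"

definition fsupport :: "(real^'n \<Rightarrow> 'k::{real_normed_field, euclidean_space}) \<Rightarrow> (real^'n) set" where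
  "fsupport f = closure {y. f y \<noteq> 0}"

definition test_functions :: "(real^'n \<Rightarrow> 'k::{real_normed_field, euclidean_space}) set" where
  "test_functions = {f. smooth f \<and> compact (fsupport f)}"

definition tf_converges ::
  "(nat \<Rightarrow> real^'n \<Rightarrow> 'k::{real_normed_field, euclidean_space}) \<Rightarrow> (real^'n \<Rightarrow> 'k) \<Rightarrow> bool" where
  "tf_converges \<Phi> \<phi> \<longleftrightarrow> (\<forall>j. \<Phi> j \<in> test_functions) \<and> \<phi> \<in> test_functions \<and>
     (\<exists>K. compact K \<and> (\<forall>j. fsupport (\<lambda>y. \<Phi> j y - \<phi> y) \<subseteq> K) \<and>
          (\<forall>\<alpha>. uniform_limit K (\<lambda>j. mderiv \<alpha> (\<Phi> j)) (mderiv \<alpha> \<phi>) sequentially))"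

text \<open>
  The locally convex topology on the test functions is the usual strict inductive limit: a base of
  neighbourhoods of 0 is given by the absolutely convex sets whose trace on the test functions
  supported in any compact \<open>K\<close> is a neighbourhood of 0 for the seminorms
  \<open>sup {norm (mderiv \<alpha> f y) | y. length \<alpha> \<le> m}\<close>.
\<close>

definition tf_zero_nbhd :: "(real^'n \<Rightarrow> 'k::{real_normed_field, euclidean_space}) set \<Rightarrow> bool" where
  "tf_zero_nbhd V \<longleftrightarrow> V \<subseteq> test_functions \<and>
     (\<forall>f\<in>V. \<forall>g\<in>V. \<forall>a b. norm a + norm b \<le> 1 \<longrightarrow> (\<lambda>y. a * f y + b * g y) \<in> V) \<and>
     (\<forall>K. compact K \<longrightarrow> (\<exists>m. \<exists>\<epsilon>>0. \<forall>f\<in>test_functions. fsupport f \<subseteq> K \<longrightarrow>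
        (\<forall>\<alpha> y. length \<alpha> \<le> m \<longrightarrow> norm (mderiv \<alpha> f y) < \<epsilon>) \<longrightarrow> f \<in> V))"

definition tf_topology :: "(real^'n \<Rightarrow> 'k::{real_normed_field, euclidean_space}) topology" where
  "tf_topology = topology (\<lambda>U. U \<subseteq> test_functions \<and>
     (\<forall>f\<in>U. \<exists>V. tf_zero_nbhd V \<and> (\<forall>g\<in>V. (\<lambda>y. f y + g y) \<in> U)))"

lemma tf_zero_nbhd_Int:
  fixes V W :: "(real^'n \<Rightarrow> 'k::{real_normed_field, euclidean_space}) set"
  assumes V: "tf_zero_nbhd V" and W: "tf_zero_nbhd W"
  shows "tf_zero_nbhd (V \<inter> W)"
proof -
  have "\<exists>m. \<exists>\<epsilon>>0. \<forall>f\<in>test_functions. fsupport f \<subseteq> K \<longrightarrow>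
        (\<forall>\<alpha> y. length \<alpha> \<le> m \<longrightarrow> norm (mderiv \<alpha> f y) < \<epsilon>) \<longrightarrow> f \<in> V \<inter> W"
    if K: "compact K" for K
  proof -
    from V K obtain m e where 1: "e > 0" "\<forall>f\<in>test_functions. fsupport f \<subseteq> K \<longrightarrow>
        (\<forall>\<alpha> y. length \<alpha> \<le> m \<longrightarrow> norm (mderiv \<alpha> f y) < e) \<longrightarrow> f \<in> V"
      unfolding tf_zero_nbhd_def by meson
    from W K obtain m' e' where 2: "e' > 0" "\<forall>f\<in>test_functions. fsupport f \<subseteq> K \<longrightarrow>
        (\<forall>\<alpha> y. length \<alpha> \<le> m' \<longrightarrow> norm (mderiv \<alpha> f y) < e') \<longrightarrow> f \<in> W"
      unfolding tf_zero_nbhd_def by meson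
    show ?thesis
    proof (rule exI[of _ "max m m'"], rule exI[of _ "min e e'"], intro conjI ballI impI)
      show "0 < min e e'" using 1(1) 2(1) by simp
      fix f :: "real^'n \<Rightarrow> 'k" assume f: "f \<in> test_functions" "fsupport f \<subseteq> K"
        "\<forall>\<alpha> y. length \<alpha> \<le> max m m' \<longrightarrow> norm (mderiv \<alpha> f y) < min e e'"
      show "f \<in> V \<inter> W" using 1(2) 2(2) f by simp
    qed
  qed
  with V W show ?thesis unfolding tf_zero_nbhd_def by (simp add: le_infI1)
qed

lemma openin_tf_topology:
  fixes U :: "(real^'n \<Rightarrow> 'k::{real_normed_field, euclidean_space}) set"
  shows "openin tf_topology U \<longleftrightarrow> U \<subseteq> test_functions \<and>
     (\<forall>f\<in>U. \<exists>V. tf_zero_nbhd V \<and> (\<forall>g\<in>V. (\<lambda>y. f y + g y) \<in> U))"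
proof -
  have "istopology (\<lambda>U :: (real^'n \<Rightarrow> 'k) set.
     U \<subseteq> test_functions \<and> (\<forall>f\<in>U. \<exists>V. tf_zero_nbhd V \<and> (\<forall>g\<in>V. (\<lambda>y. f y + g y) \<in> U)))"
    (is "istopology ?P")
    unfolding istopology_def
  proof (rule conjI; intro allI impI)
    fix S T :: "(real^'n \<Rightarrow> 'k) set" assume S: "?P S" and T: "?P T"
    have "\<exists>V. tf_zero_nbhd V \<and> (\<forall>g\<in>V. (\<lambda>y. f y + g y) \<in> S \<inter> T)" if f: "f \<in> S \<inter> T" for f
    proof -
      obtain V where "tf_zero_nbhd V" "\<forall>g\<in>V. (\<lambda>y. f y + g y) \<in> S" using S f by blast
      moreover obtain W where "tf_zero_nbhd W" "\<forall>g\<in>W. (\<lambda>y. f y + g y) \<in> T" using T f by blast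
      ultimately show ?thesis by (meson IntD1 IntD2 IntI tf_zero_nbhd_Int)
    qed
    then show "?P (S \<inter> T)" using S by blast
  next
    fix \<U> :: "(real^'n \<Rightarrow> 'k) set set" assume *: "\<forall>S\<in>\<U>. ?P S"
    have "\<exists>V. tf_zero_nbhd V \<and> (\<forall>g\<in>V. (\<lambda>y. f y + g y) \<in> \<Union>\<U>)" if f: "f \<in> \<Union>\<U>" for f
    proof -
      obtain S where S: "S \<in> \<U>" "f \<in> S" using f by blast
      then obtain V where "tf_zero_nbhd V" "\<forall>g\<in>V. (\<lambda>y. f y + g y) \<in> S" using * by blast
      then show ?thesis using S by blast
    qed
    then show "?P (\<Union>\<U>)" using * by blast
  qed
  then show ?thesis unfolding tf_topology_def by (simp add: topology_inverse')
qed

section \<open>The norms\<close>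

definition Lp :: "ennreal \<Rightarrow> (real^'n \<Rightarrow> 'k::{real_normed_field, euclidean_space}) set" where
  "Lp p = {f \<in> borel_measurable lebesgue.
     if p = \<infinity> then \<exists>C. AE y in lebesgue. norm (f y) \<le> C
     else integrable lebesgue (\<lambda>y. norm (f y) powr enn2real p)}"

text \<open>
  Edge length \<open>1 / (2 ^ l * sqrt n)\<close> for \<open>l = 1, 2, ...\<close>, hence half-edge
  \<open>1 / (2 * 2 ^ Suc l * sqrt n)\<close> for \<open>l = 0, 1, ...\<close>.
\<close>

definition rcube :: "(nat \<Rightarrow> real^'n) \<Rightarrow> nat \<Rightarrow> nat \<Rightarrow> (real^'n) set" where
  "rcube x l i = (let h = 1 / (2 ^ Suc l * sqrt (real CARD('n))) / 2
                  in cbox (x i - (\<chi> j. h)) (x i + (\<chi> j. h)))"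

text \<open>
  Choosing the Cantor pairing for the bijection between pairs and numbers loses no generality,
  because the weights \<open>t\<close> below are arbitrary.
\<close>

definition KS_cube :: "(nat \<Rightarrow> real^'n) \<Rightarrow> nat \<Rightarrow> (real^'n) set" where
  "KS_cube x k = (case prod_decode k of (l, i) \<Rightarrow> rcube x l i)"

definition KS_coeff ::
  "(nat \<Rightarrow> real^'n) \<Rightarrow> nat \<Rightarrow> (real^'n \<Rightarrow> 'k) \<Rightarrow> 'k::{real_normed_field, euclidean_space}" where
  "KS_coeff x k f = (LINT y|lebesgue. indicator (KS_cube x k) y *\<^sub>R f y)"

definition KS_norm ::
  "(nat \<Rightarrow> real^'n) \<Rightarrow> (nat \<Rightarrow> real) \<Rightarrow> ennreal \<Rightarrow>
   (real^'n \<Rightarrow> 'k::{real_normed_field, euclidean_space}) \<Rightarrow> real" where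
  "KS_norm x t p f =
     (if p = \<infinity> then SUP k. norm (KS_coeff x k f)
      else (\<Sum>k. t k * norm (KS_coeff x k f) powr enn2real p) powr (1 / enn2real p))"

section \<open>The completion\<close>

text \<open>
  The completion of \<open>Lp p\<close> for \<open>KS_norm\<close> is the space of Cauchy sequences modulo sequences
  with difference tending to 0. Since \<open>KS_norm\<close> of an \<open>Lp\<close> function vanishes exactly when the
  function is 0 almost everywhere, this also identifies functions that agree almost everywhere.
\<close>

definition KS_Cauchy ::
  "(nat \<Rightarrow> real^'n) \<Rightarrow> (nat \<Rightarrow> real) \<Rightarrow> ennreal \<Rightarrow>
   (nat \<Rightarrow> real^'n \<Rightarrow> 'k::{real_normed_field, euclidean_space}) set" where
  "KS_Cauchy x t p = {S. (\<forall>j. S j \<in> Lp p) \<and>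
     (\<forall>\<epsilon>>0. \<exists>N. \<forall>m\<ge>N. \<forall>n\<ge>N. KS_norm x t p (\<lambda>y. S m y - S n y) < \<epsilon>)}"

definition KS_rel ::
  "(nat \<Rightarrow> real^'n) \<Rightarrow> (nat \<Rightarrow> real) \<Rightarrow> ennreal \<Rightarrow>
   (nat \<Rightarrow> real^'n \<Rightarrow> 'k::{real_normed_field, euclidean_space}) rel" where
  "KS_rel x t p = {(S, T). S \<in> KS_Cauchy x t p \<and> T \<in> KS_Cauchy x t p \<and>
     (\<lambda>j. KS_norm x t p (\<lambda>y. S j y - T j y)) \<longlonglongrightarrow> 0}"

definition KS_space ::
  "(nat \<Rightarrow> real^'n) \<Rightarrow> (nat \<Rightarrow> real) \<Rightarrow> ennreal \<Rightarrow>
   (nat \<Rightarrow> real^'n \<Rightarrow> 'k::{real_normed_field, euclidean_space}) set set" where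
  "KS_space x t p = KS_Cauchy x t p // KS_rel x t p"

definition KS_embed ::
  "(nat \<Rightarrow> real^'n) \<Rightarrow> (nat \<Rightarrow> real) \<Rightarrow> ennreal \<Rightarrow> (real^'n \<Rightarrow> 'k) \<Rightarrow>
   (nat \<Rightarrow> real^'n \<Rightarrow> 'k::{real_normed_field, euclidean_space}) set" where
  "KS_embed x t p f = KS_rel x t p `` {\<lambda>_. f}"

definition KS_add ::
  "(nat \<Rightarrow> real^'n) \<Rightarrow> (nat \<Rightarrow> real) \<Rightarrow> ennreal \<Rightarrow>
   (nat \<Rightarrow> real^'n \<Rightarrow> 'k) set \<Rightarrow> (nat \<Rightarrow> real^'n \<Rightarrow> 'k) set \<Rightarrow>
   (nat \<Rightarrow> real^'n \<Rightarrow> 'k::{real_normed_field, euclidean_space}) set" where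
  "KS_add x t p X Y = (\<Union>S\<in>X. \<Union>T\<in>Y. KS_rel x t p `` {\<lambda>j y. S j y + T j y})"

definition KS_scale ::
  "(nat \<Rightarrow> real^'n) \<Rightarrow> (nat \<Rightarrow> real) \<Rightarrow> ennreal \<Rightarrow> 'k \<Rightarrow>
   (nat \<Rightarrow> real^'n \<Rightarrow> 'k) set \<Rightarrow>
   (nat \<Rightarrow> real^'n \<Rightarrow> 'k::{real_normed_field, euclidean_space}) set" where
  "KS_scale x t p c X = (\<Union>S\<in>X. KS_rel x t p `` {\<lambda>j y. c * S j y})"

text \<open>
  The distance induced by the extended norm. The limit does not depend on the representatives; the
  value 0 off the carrier is there only because \<open>Metric_space\<close> wants a nonnegative symmetric
  function on the whole type.
\<close>

definition KS_dist ::
  "(nat \<Rightarrow> real^'n) \<Rightarrow> (nat \<Rightarrow> real) \<Rightarrow> ennreal \<Rightarrow>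
   (nat \<Rightarrow> real^'n \<Rightarrow> 'k) set \<Rightarrow>
   (nat \<Rightarrow> real^'n \<Rightarrow> 'k::{real_normed_field, euclidean_space}) set \<Rightarrow> real" where
  "KS_dist x t p X Y =
     (if X \<in> KS_space x t p \<and> Y \<in> KS_space x t p
      then THE d. \<forall>S\<in>X. \<forall>T\<in>Y. (\<lambda>j. KS_norm x t p (\<lambda>y. S j y - T j y)) \<longlonglongrightarrow> d
      else 0)"

definition KS_topology ::
  "(nat \<Rightarrow> real^'n) \<Rightarrow> (nat \<Rightarrow> real) \<Rightarrow> ennreal \<Rightarrow>
   (nat \<Rightarrow> real^'n \<Rightarrow> 'k::{real_normed_field, euclidean_space}) set topology" where
  "KS_topology x t p = Metric_space.mtopology (KS_space x t p) (KS_dist x t p)"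

end

theory Submission
  imports Defs
begin

text \<open>
  Two estimates carry the theorem. Every cube \<open>KS_cube x k\<close> has volume at most 1, so each
  coefficient of \<open>f\<close> is bounded by \<open>sup norm f\<close> (\<open>KS_coeff_le_sup\<close>); and as the weights sum to 1,
  the weighted \<open>p\<close>-mean of the coefficients is bounded by their supremum (\<open>wnorm_le_bound\<close>). Hence
  the norm of a bounded function is at most its supremum norm (\<open>pdist_le_sup\<close>), for every \<open>p\<close>
  including \<open>\<infinity>\<close>. Convergence of test functions implies uniform convergence on the whole space,
  and \<open>{f. sup norm f \<le> \<epsilon>}\<close> is a neighbourhood of 0 in the inductive limit topology
  (\<open>tf_zero_nbhd_sup_ball\<close>), so the embedding is continuous both sequentially and topologically.

  Injectivity holds because the rational points are dense and the edges tend to 0: the cubes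
  shrink to any given point, so a continuous function all of whose integrals over the cubes vanish
  is itself 0 (\<open>continuous_zero_if_KS_coeffs_zero\<close>).

  The remaining work is to see that the completion is a metric space in which these estimates may
  be read. The norm is the weighted sequence norm of the coefficients, so it inherits the triangle
  inequality from Minkowski's inequality for sequences (\<open>wnorm_triangle\<close>), provided the
  integrals of an \<open>L\<^sup>p\<close> function over the cubes exist and are bounded in \<open>k\<close> (\<open>Lp_cube_integrable\<close>). From
  then on the standard arguments about Cauchy sequences modulo null sequences apply, and the
  distance of the classes of two constant sequences is the norm of the difference.
\<close>

section \<open>Weighted sequence norms\<close>

text \<open>
  This is \<open>KS_norm\<close> with the coefficients replaced by an arbitrary sequence, which separates the
  \<open>\<ell>\<^sup>p\<close> theory from the integration theory.
\<close>

definition wnorm :: "(nat \<Rightarrow> real) \<Rightarrow> ennreal \<Rightarrow> (nat \<Rightarrow> 'a::real_normed_vector) \<Rightarrow> real" where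
  "wnorm t p a =
     (if p = \<infinity> then SUP k. norm (a k)
      else (\<Sum>k. t k * norm (a k) powr enn2real p) powr (1 / enn2real p))"

text \<open>
  On the open half-line this is \<open>powr_convex\<close>; at an endpoint 0 it amounts to \<open>w powr q \<le> w\<close> for
  \<open>w\<close> in the unit interval.
\<close>

lemma convex_powr_nonneg:
  fixes a b u v q :: real
  assumes "1 \<le> q" "0 \<le> a" "0 \<le> b" "0 \<le> u" "0 \<le> v" "u + v = 1"
  shows "(u * a + v * b) powr q \<le> u * a powr q + v * b powr q"
proof -
  have scaled: "(w * c) powr q \<le> w * c powr q" if "0 \<le> w" "w \<le> 1" "0 \<le> c" for w c :: real
  proof -
    have "w powr q \<le> w"
      using that assms(1) powr_mono'[of 1 q w] by simp
    then show ?thesis using that by (simp add: powr_mult mult_right_mono)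
  qed
  consider "a = 0" | "b = 0" | "0 < a" "0 < b" using assms by linarith
  then show ?thesis
  proof cases
    case 1 then show ?thesis using scaled[of v b] assms by simp
  next
    case 2 then show ?thesis using scaled[of u a] assms by simp
  next
    case 3
    have "((1 - v) *\<^sub>R a + v *\<^sub>R b) powr q \<le> (1 - v) * a powr q + v * b powr q"
      using convex_onD[OF powr_convex[OF assms(1)], of v a b] 3 assms by simp
    moreover have "1 - v = u" using assms(6) by simp
    ultimately show ?thesis by simp
  qed
qed

locale weighted_seq =
  fixes t :: "nat \<Rightarrow> real" and p :: ennreal
  assumes t_pos: "\<And>k. 0 < t k" and t_sums: "t sums 1" and p_ge_1: "1 \<le> p"
begin

lemma exponent_ge_1: "p \<noteq> \<infinity> \<Longrightarrow> 1 \<le> enn2real p"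
  using p_ge_1 enn2real_mono[of 1 p] by (simp add: top.not_eq_extremum)

lemma summable_weighted:
  assumes "Bseq a"
  shows "summable (\<lambda>k. t k * norm (a k) powr enn2real p)"
proof -
  from assms obtain C where C: "\<And>k. norm (a k) \<le> C" by (auto simp: Bseq_def)
  show ?thesis
  proof (rule summable_comparison_test')
    show "summable (\<lambda>k. t k * C powr enn2real p)"
      using t_sums by (intro summable_mult2) (simp add: sums_iff)
    show "norm (t k * norm (a k) powr enn2real p) \<le> t k * C powr enn2real p" if "0 \<le> k" for k
      using C[of k] t_pos[of k] by (auto simp: abs_mult intro!: mult_left_mono powr_mono2)
  qed
qed

lemma bdd_above_norm: "Bseq a \<Longrightarrow> bdd_above (range (\<lambda>k. norm (a k)))"
  by (auto simp: Bseq_def bdd_above_def)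

lemma wnorm_nonneg: "Bseq a \<Longrightarrow> 0 \<le> wnorm t p a"
  unfolding wnorm_def
  by (auto intro!: order_trans[OF norm_ge_zero cSUP_upper[of 0]] bdd_above_norm)

lemma wnorm_powr:
  assumes "Bseq a" "p \<noteq> \<infinity>"
  shows "wnorm t p a powr enn2real p = (\<Sum>k. t k * norm (a k) powr enn2real p)"
proof -
  have "0 \<le> (\<Sum>k. t k * norm (a k) powr enn2real p)"
    by (intro suminf_nonneg summable_weighted assms mult_nonneg_nonneg less_imp_le[OF t_pos]) simp
  then show ?thesis
    using assms exponent_ge_1 by (simp add: wnorm_def powr_powr)
qed

lemma wnorm_leI:
  assumes "p \<noteq> \<infinity>" "0 \<le> M" "Bseq a"
    and "(\<Sum>k. t k * norm (a k) powr enn2real p) \<le> M powr enn2real p"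
  shows "wnorm t p a \<le> M"
proof (rule ccontr)
  assume "\<not> wnorm t p a \<le> M"
  then have "M powr enn2real p < wnorm t p a powr enn2real p"
    using assms exponent_ge_1 by (intro powr_less_mono2) auto
  then show False using assms by (simp add: wnorm_powr)
qed

text \<open>
  The weights have total mass 1, so a weighted mean of powers does not exceed the largest of them.
\<close>

lemma wnorm_le_bound:
  assumes C: "\<And>k. norm (a k) \<le> C"
  shows "wnorm t p a \<le> C"
proof (cases "p = \<infinity>")
  case True
  then show ?thesis unfolding wnorm_def using C by (auto intro: cSUP_least)
next
  case False
  have B: "Bseq a" using C by (rule BseqI')
  have C0: "0 \<le> C" using order_trans[OF norm_ge_zero C] .
  have "(\<Sum>k. t k * norm (a k) powr enn2real p) \<le> (\<Sum>k. t k * C powr enn2real p)"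
    using t_sums t_pos C
    by (intro suminf_le summable_weighted B mult_left_mono powr_mono2 summable_mult2)
       (auto simp: sums_iff less_imp_le)
  also have "\<dots> = C powr enn2real p"
    using t_sums by (simp add: suminf_mult2[symmetric] sums_iff)
  finally show ?thesis by (rule wnorm_leI[OF False C0 B])
qed

text \<open>
  Monotonicity and homogeneity in one statement: it yields the norm of a scalar multiple as well
  as that of the negative of a sequence.
\<close>

lemma wnorm_dominated:
  assumes b: "Bseq b" and c: "0 \<le> c" and le: "\<And>k. norm (a k) \<le> c * norm (b k)"
  shows "wnorm t p a \<le> c * wnorm t p b"
proof (cases "p = \<infinity>")
  case True
  have "norm (a k) \<le> c * (SUP k. norm (b k))" for k
    using le[of k] cSUP_upper[OF _ bdd_above_norm[OF b], of k] c
    by (meson UNIV_I mult_left_mono order_trans)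
  then show ?thesis using True by (auto simp: wnorm_def intro: cSUP_least)
next
  case False
  obtain C where C: "\<And>k. norm (b k) \<le> C" using b by (auto simp: Bseq_def)
  have a: "Bseq a"
    by (rule BseqI'[of _ "c * C"]) (meson C c le mult_left_mono order_trans)
  have "(\<Sum>k. t k * norm (a k) powr enn2real p)
      \<le> (\<Sum>k. c powr enn2real p * (t k * norm (b k) powr enn2real p))"
  proof (intro suminf_le summable_mult summable_weighted a b)
    fix k
    have "norm (a k) powr enn2real p \<le> (c * norm (b k)) powr enn2real p"
      using le by (intro powr_mono2) auto
    then show "t k * norm (a k) powr enn2real p
        \<le> c powr enn2real p * (t k * norm (b k) powr enn2real p)"
      using t_pos[of k] c by (simp add: powr_mult mult.left_commute)
  qed
  also have "\<dots> = (c * wnorm t p b) powr enn2real p"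
    using b False c
    by (simp add: suminf_mult summable_weighted wnorm_powr wnorm_nonneg powr_mult)
  finally show ?thesis
    using False a b c by (intro wnorm_leI) (auto simp: wnorm_nonneg)
qed

lemma wnorm_eq_0D:
  assumes "Bseq a" "wnorm t p a = 0"
  shows "a k = 0"
proof (cases "p = \<infinity>")
  case True
  then show ?thesis
    using cSUP_upper[OF _ bdd_above_norm[OF assms(1)], of k] assms(2) by (simp add: wnorm_def)
next
  case False
  have "(\<Sum>k. t k * norm (a k) powr enn2real p) = 0"
    using wnorm_powr[OF assms(1) False] assms(2) by simp
  then have "t k * norm (a k) powr enn2real p = 0"
    using suminf_eq_zero_iff[OF summable_weighted[OF assms(1)]] t_pos
    by (simp add: less_imp_le)
  then show ?thesis using t_pos[of k] by simp
qed

text \<open>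
  Minkowski's inequality, from the convexity of \<open>s powr q\<close> applied to the sequences scaled to
  norm 1. A sequence of norm 0 cannot be
  normalised, but it is the zero sequence because all weights are positive.
\<close>

lemma wnorm_triangle:
  fixes a b :: "nat \<Rightarrow> 'a::real_normed_vector"
  assumes a: "Bseq a" and b: "Bseq b"
  shows "wnorm t p (\<lambda>k. a k + b k) \<le> wnorm t p a + wnorm t p b"
proof (cases "p = \<infinity>")
  case True
  have "norm (a k + b k) \<le> (SUP k. norm (a k)) + (SUP k. norm (b k))" for k
    by (intro norm_triangle_le add_mono cSUP_upper bdd_above_norm a b) auto
  then show ?thesis using True by (auto simp: wnorm_def intro: cSUP_least)
next
  case False
  define q where "q = enn2real p"
  have q: "1 \<le> q" using False exponent_ge_1 q_def by simp
  define A B where "A = wnorm t p a" and "B = wnorm t p b"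
  have A0: "0 \<le> A" and B0: "0 \<le> B" by (auto simp: A_def B_def a b wnorm_nonneg)
  consider "A = 0" | "B = 0" | "0 < A" "0 < B" using A0 B0 by linarith
  then show ?thesis
  proof cases
    case 1
    then have "a = (\<lambda>_. 0)" using wnorm_eq_0D[OF a] by (auto simp: A_def)
    then show ?thesis using 1 by (simp add: A_def)
  next
    case 2
    then have "b = (\<lambda>_. 0)" using wnorm_eq_0D[OF b] by (auto simp: B_def)
    then show ?thesis using 2 by (simp add: B_def)
  next
    case 3
    have ab: "Bseq (\<lambda>k. a k + b k)"
    proof -
      obtain C D where "\<And>k. norm (a k) \<le> C" "\<And>k. norm (b k) \<le> D"
        using a b by (auto simp: Bseq_def)
      then show ?thesis by (intro BseqI'[of _ "C + D"]) (meson add_mono norm_triangle_le)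
    qed
    define M where "M = (A + B) powr q"
    \<comment> \<open>\<open>(a + b) / (A + B)\<close> is the convex combination of the normalised sequences \<open>a / A\<close>
       and \<open>b / B\<close> with weights \<open>A / (A + B)\<close> and \<open>B / (A + B)\<close>.\<close>
    have pt: "norm (a k + b k) powr q
        \<le> M * (A / (A + B) / A powr q * norm (a k) powr q
             + B / (A + B) / B powr q * norm (b k) powr q)" for k
    proof -
      have "norm (a k + b k) powr q \<le> (norm (a k) + norm (b k)) powr q"
        using q by (intro powr_mono2 norm_triangle_ineq) auto
      also have "norm (a k) + norm (b k)
          = (A + B) * (A / (A + B) * (norm (a k) / A) + B / (A + B) * (norm (b k) / B))"
        using 3 by (simp add: add_divide_distrib[symmetric])
      also have "\<dots> powr q
          = M * (A / (A + B) * (norm (a k) / A) + B / (A + B) * (norm (b k) / B)) powr q"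
        using 3 by (simp add: powr_mult M_def)
      also have "\<dots> \<le> M * (A / (A + B) * (norm (a k) / A) powr q
                          + B / (A + B) * (norm (b k) / B) powr q)"
        using 3 q by (intro mult_left_mono convex_powr_nonneg)
          (auto simp: M_def add_divide_distrib[symmetric])
      finally show ?thesis using 3 by (simp add: powr_divide)
    qed
    have sa: "(\<lambda>k. t k * norm (a k) powr q) sums (A powr q)"
      using summable_sums[OF summable_weighted[OF a]] wnorm_powr[OF a False]
      by (simp add: A_def q_def)
    have sb: "(\<lambda>k. t k * norm (b k) powr q) sums (B powr q)"
      using summable_sums[OF summable_weighted[OF b]] wnorm_powr[OF b False]
      by (simp add: B_def q_def)
    have "(\<Sum>k. t k * norm (a k + b k) powr q)
        \<le> M * (A / (A + B) / A powr q * A powr q + B / (A + B) / B powr q * B powr q)"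
    proof (rule sums_le[OF _ summable_sums])
      show "summable (\<lambda>k. t k * norm (a k + b k) powr q)"
        unfolding q_def by (rule summable_weighted[OF ab])
      show "(\<lambda>k. M * (A / (A + B) / A powr q * (t k * norm (a k) powr q)
                    + B / (A + B) / B powr q * (t k * norm (b k) powr q)))
         sums (M * (A / (A + B) / A powr q * A powr q + B / (A + B) / B powr q * B powr q))"
        by (intro sums_mult sums_add sa sb)
      fix k
      show "t k * norm (a k + b k) powr q
          \<le> M * (A / (A + B) / A powr q * (t k * norm (a k) powr q)
               + B / (A + B) / B powr q * (t k * norm (b k) powr q))"
        using mult_left_mono[OF pt less_imp_le[OF t_pos], of k k] by (simp add: algebra_simps)
    qed
    also have "\<dots> = M"
      using 3 by (simp add: add_divide_distrib[symmetric])
    finally show ?thesis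
      using False ab A0 B0 by (intro wnorm_leI) (auto simp: M_def q_def A_def B_def)
  qed
qed

end

section \<open>Integration over the cubes\<close>

text \<open>
  In the finite case \<open>norm (c * f y + d * g y)\<close> is at most \<open>norm c + norm d\<close> times the larger of
  the two norms, and the power of a maximum is at most the sum of the powers.
\<close>

lemma Lp_lincomb:
  fixes f g :: "real^'n \<Rightarrow> 'k::{real_normed_field, euclidean_space}"
  assumes f: "f \<in> Lp p" and g: "g \<in> Lp p"
  shows "(\<lambda>y. c * f y + d * g y) \<in> Lp p"
proof -
  have m [measurable]: "f \<in> borel_measurable lebesgue" "g \<in> borel_measurable lebesgue"
    using f g by (auto simp: Lp_def)
  show ?thesis
  proof (cases "p = \<infinity>")
    case True
    obtain C D where C: "AE y in lebesgue. norm (f y) \<le> C" and D: "AE y in lebesgue. norm (g y) \<le> D"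
      using f g True by (auto simp: Lp_def)
    have "AE y in lebesgue. norm (c * f y + d * g y) \<le> norm c * C + norm d * D"
      using C D
    proof eventually_elim
      case (elim y)
      then show ?case
        by (intro norm_triangle_le add_mono) (auto simp: norm_mult intro: mult_left_mono)
    qed
    then show ?thesis using True by (auto simp: Lp_def)
  next
    case False
    define q where "q = enn2real p"
    define M where "M = norm c + norm d"
    have fi: "integrable lebesgue (\<lambda>y. norm (f y) powr q)"
      and gi: "integrable lebesgue (\<lambda>y. norm (g y) powr q)"
      using f g False by (auto simp: Lp_def q_def)
    have "integrable lebesgue (\<lambda>y. norm (c * f y + d * g y) powr q)"
    proof (rule Bochner_Integration.integrable_bound)
      show "integrable lebesgue (\<lambda>y. M powr q * (norm (f y) powr q + norm (g y) powr q))"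
        using fi gi by simp
      show "(\<lambda>y. norm (c * f y + d * g y) powr q) \<in> borel_measurable lebesgue"
        by measurable
      show "AE y in lebesgue. norm (norm (c * f y + d * g y) powr q)
          \<le> norm (M powr q * (norm (f y) powr q + norm (g y) powr q))"
      proof (rule AE_I2)
        fix y
        define m where "m = max (norm (f y)) (norm (g y))"
        have "norm (c * f y + d * g y) \<le> norm c * m + norm d * m"
          by (intro norm_triangle_le add_mono) (auto simp: norm_mult m_def intro: mult_left_mono)
        then have "norm (c * f y + d * g y) powr q \<le> (M * m) powr q"
          by (intro powr_mono2) (auto simp: q_def M_def algebra_simps)
        also have "\<dots> = M powr q * m powr q"
          by (simp add: M_def m_def powr_mult)
        also have "\<dots> \<le> M powr q * (norm (f y) powr q + norm (g y) powr q)"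
          by (intro mult_left_mono) (auto simp: m_def max_def)
        finally show "norm (norm (c * f y + d * g y) powr q)
            \<le> norm (M powr q * (norm (f y) powr q + norm (g y) powr q))"
          by simp
      qed
    qed
    then show ?thesis using False by (auto simp: Lp_def q_def)
  qed
qed

text \<open>
  The dimension enters only through the index type, which is therefore passed as an argument.
\<close>

definition half_edge :: "'n::finite itself \<Rightarrow> nat \<Rightarrow> real" where
  "half_edge _ l = 1 / (2 ^ Suc l * sqrt (real CARD('n))) / 2"

lemma half_edge_pos: "0 < half_edge TYPE('n::finite) l"
  by (simp add: half_edge_def)

lemma half_edge_le: "half_edge TYPE('n::finite) l \<le> (1 / 2) ^ Suc l / 2"
proof -
  have "1 \<le> sqrt (real CARD('n))"
    using one_le_card_finite[where 'a='n] by simp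
  then show ?thesis
    by (simp add: half_edge_def power_divide field_simps)
qed

lemma rcube_eq:
  fixes x :: "nat \<Rightarrow> real^'n"
  shows "rcube x l i = cbox (x i - (\<chi> j. half_edge TYPE('n) l)) (x i + (\<chi> j. half_edge TYPE('n) l))"
  by (simp add: rcube_def half_edge_def Let_def)

lemma KS_cube_measure:
  fixes x :: "nat \<Rightarrow> real^'n"
  shows "KS_cube x k \<in> lmeasurable" "0 < measure lebesgue (KS_cube x k)"
    "measure lebesgue (KS_cube x k) \<le> 1"
proof -
  obtain l i where li: "prod_decode k = (l, i)" by force
  let ?h = "half_edge TYPE('n) l"
  have cube: "KS_cube x k = cbox (x i - (\<chi> j. ?h)) (x i + (\<chi> j. ?h))"
    using li by (simp add: KS_cube_def rcube_eq)
  have h: "0 < ?h" "?h \<le> (1 / 2) ^ Suc l / 2" by (rule half_edge_pos half_edge_le)+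
  have h1: "2 * ?h \<le> 1"
    using h(2) power_le_one[of "1/2 :: real" "Suc l"] by linarith
  have "measure lborel (KS_cube x k) = (2 * ?h) ^ CARD('n)"
    using h(1) unfolding cube
    by (subst content_cbox_if_cart) (auto simp: interval_eq_empty_cart not_less[symmetric])
  then show "0 < measure lebesgue (KS_cube x k)" "measure lebesgue (KS_cube x k) \<le> 1"
    using h(1) h1 power_le_one[of "2 * ?h" "CARD('n)"] by (auto simp: cube)
  show "KS_cube x k \<in> lmeasurable" by (simp add: cube)
qed

lemma integrable_const_on_cube:
  fixes c :: "'k::{real_normed_field, euclidean_space}"
  shows "integrable lebesgue (\<lambda>y. indicator (KS_cube x k) y *\<^sub>R c)"
  using KS_cube_measure(1)[of x k] by (intro integrable_scaleR_left) (simp add: fmeasurable_def integrable_indicator_iff del: emeasure_completion)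

lemma integral_const_on_cube:
  fixes c :: "'k::{real_normed_field, euclidean_space}"
  shows "(LINT y|lebesgue. indicator (KS_cube x k) y *\<^sub>R c) = measure lebesgue (KS_cube x k) *\<^sub>R c"
  using KS_cube_measure(1)[of x k]
  by (subst integral_scaleR_left) (simp_all add: fmeasurable_def integrable_indicator_iff del: emeasure_completion)

text \<open>
  For \<open>p\<close> finite, \<open>norm (f y) \<le> 1 + norm (f y) powr p\<close>; together with the essentially bounded case
  this gives a majorant \<open>C + g\<close> with \<open>g\<close> integrable. Its integral over a set of measure at most 1 is
  bounded by \<open>C + \<integral> g\<close>, independently of the cube.
\<close>

lemma Lp_cube_integrable:
  fixes f :: "real^'n \<Rightarrow> 'k::{real_normed_field, euclidean_space}"
  assumes p: "1 \<le> p" and f: "f \<in> Lp p"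
  shows "integrable lebesgue (\<lambda>y. indicator (KS_cube x k) y *\<^sub>R f y)" (is ?int)
    and "\<exists>C. \<forall>k. norm (KS_coeff x k f) \<le> C" (is ?bdd)
proof -
  have fm [measurable]: "f \<in> borel_measurable lebesgue" using f by (simp add: Lp_def)
  have cm [measurable]: "KS_cube x k \<in> sets lebesgue" for k
    using KS_cube_measure(1)[of x k] by (rule fmeasurableD)
  have ci: "integrable lebesgue (\<lambda>y. C * indicator (KS_cube x k) y)" for k and C :: real
    using integrable_const_on_cube[of x k C] by (simp add: mult.commute)
  obtain C and g :: "real^'n \<Rightarrow> real" where
    g: "integrable lebesgue g" "\<And>y. 0 \<le> g y" and C: "0 \<le> C"
    and le: "AE y in lebesgue. norm (f y) \<le> C + g y"
  proof (cases "p = \<infinity>")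
    case True
    then obtain C where "AE y in lebesgue. norm (f y) \<le> C" using f by (auto simp: Lp_def)
    then have "AE y in lebesgue. norm (f y) \<le> \<bar>C\<bar> + 0"
      by eventually_elim simp
    then show thesis by (intro that[of "\<lambda>_. 0" "\<bar>C\<bar>"]) auto
  next
    case False
    define q where "q = enn2real p"
    have q: "1 \<le> q"
      using p False enn2real_mono[of 1 p] by (simp add: q_def top.not_eq_extremum)
    have "s \<le> 1 + s powr q" if "0 \<le> s" for s :: real
    proof (cases "s \<le> 1")
      case True then show ?thesis by (simp add: add_increasing2)
    next
      case False
      then have "s powr 1 \<le> s powr q" using q by (intro powr_mono) auto
      then show ?thesis using False by simp
    qed
    then show thesis
      using f False by (intro that[of "\<lambda>y. norm (f y) powr q" 1]) (auto simp: Lp_def q_def)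
  qed
  have dom: "AE y in lebesgue.
      norm (indicator (KS_cube x k) y *\<^sub>R f y) \<le> C * indicator (KS_cube x k) y + g y" for k
    using le
  proof eventually_elim
    case (elim y)
    then show ?case using g(2)[of y] by (auto simp: indicator_def)
  qed
  have dint: "integrable lebesgue (\<lambda>y. C * indicator (KS_cube x k) y + g y)" for k
    using ci g(1) by simp
  have int: "integrable lebesgue (\<lambda>y. indicator (KS_cube x k) y *\<^sub>R f y)" for k
  proof (rule Bochner_Integration.integrable_bound[OF dint[of k]])
    show "AE y in lebesgue. norm (indicator (KS_cube x k) y *\<^sub>R f y)
        \<le> norm (C * indicator (KS_cube x k) y + g y)"
      using dom[of k] by eventually_elim (simp add: order_trans[OF _ abs_ge_self])
  qed measurable
  then show ?int .
  have "norm (KS_coeff x k f) \<le> C + (LINT y|lebesgue. g y)" for k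
  proof -
    have "norm (KS_coeff x k f) \<le> (LINT y|lebesgue. norm (indicator (KS_cube x k) y *\<^sub>R f y))"
      unfolding KS_coeff_def by (rule integral_norm_bound)
    also have "\<dots> \<le> (LINT y|lebesgue. C * indicator (KS_cube x k) y + g y)"
      by (rule integral_mono_AE[OF integrable_norm[OF int] dint dom])
    also have "\<dots> = C * measure lebesgue (KS_cube x k) + (LINT y|lebesgue. g y)"
      using ci[of C k] g(1) by simp
    also have "\<dots> \<le> C + (LINT y|lebesgue. g y)"
      using mult_left_le[OF KS_cube_measure(3) C] by simp
    finally show ?thesis .
  qed
  then show ?bdd by blast
qed

lemma KS_coeff_lincomb:
  fixes f g :: "real^'n \<Rightarrow> 'k::{real_normed_field, euclidean_space}"
  assumes "1 \<le> p" "f \<in> Lp p" "g \<in> Lp p"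
  shows "KS_coeff x k (\<lambda>y. c * f y + d * g y) = c * KS_coeff x k f + d * KS_coeff x k g"
proof -
  have "KS_coeff x k (\<lambda>y. c * f y + d * g y) = (LINT y|lebesgue.
      c * (indicator (KS_cube x k) y *\<^sub>R f y) + d * (indicator (KS_cube x k) y *\<^sub>R g y))"
    unfolding KS_coeff_def by (simp add: scaleR_add_right)
  also have "\<dots> = c * KS_coeff x k f + d * KS_coeff x k g"
    unfolding KS_coeff_def
    using Lp_cube_integrable(1)[OF assms(1,2), of x k] Lp_cube_integrable(1)[OF assms(1,3), of x k]
    by (simp del: mult_scaleR_right)
  finally show ?thesis .
qed

lemma KS_coeff_le_sup:
  fixes f :: "real^'n \<Rightarrow> 'k::{real_normed_field, euclidean_space}"
  assumes C: "\<And>y. norm (f y) \<le> C"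
  shows "norm (KS_coeff x k f) \<le> C"
proof -
  have C0: "0 \<le> C" using order_trans[OF norm_ge_zero C] .
  have "norm (KS_coeff x k f) \<le> (LINT y|lebesgue. indicator (KS_cube x k) y *\<^sub>R C)"
  proof (cases "integrable lebesgue (\<lambda>y. indicator (KS_cube x k) y *\<^sub>R f y)")
    case True
    show ?thesis unfolding KS_coeff_def
      by (rule Bochner_Integration.integral_norm_bound_integral[OF True integrable_const_on_cube])
         (use C in \<open>auto simp: indicator_def\<close>)
  next
    case False
    then show ?thesis
      using C0 by (auto simp: KS_coeff_def not_integrable_integral_eq intro!: Bochner_Integration.integral_nonneg)
  qed
  also have "\<dots> = measure lebesgue (KS_cube x k) * C"
    by (simp add: integral_const_on_cube)
  also have "\<dots> \<le> C"
    using mult_right_mono[OF KS_cube_measure(3) C0] by simp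
  finally show ?thesis .
qed

lemma rational_points_dense:
  fixes y :: "real^'n"
  assumes e: "0 < e"
  obtains q where "\<And>i. q $ i \<in> \<rat>" "dist q y < e"
proof -
  have "\<exists>r\<in>\<rat>. \<bar>r - y $ i\<bar> < e / (2 * real CARD('n))" for i
    using rational_approximation[of "e / (2 * real CARD('n))" "y $ i"] e by auto
  then obtain r where r: "\<And>i. r i \<in> \<rat>" "\<And>i. \<bar>r i - y $ i\<bar> < e / (2 * real CARD('n))"
    by metis
  have "dist (\<chi> i. r i) y \<le> (\<Sum>i\<in>UNIV. \<bar>r i - y $ i\<bar>)"
    using norm_le_l1_cart[of "(\<chi> i. r i) - y"] by (simp add: dist_norm)
  also have "\<dots> \<le> real CARD('n) * (e / (2 * real CARD('n)))"
    using r(2) by (intro sum_bounded_above) (simp add: less_imp_le)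
  also have "\<dots> < e" using e by simp
  finally show thesis using r(1) by (intro that[of "\<chi> i. r i"]) auto
qed

text \<open>
  A cube with rational centre within \<open>e / 2\<close> of \<open>y\<close> works once its half-edge, multiplied by the
  dimension, is below \<open>e / 2\<close>: that product bounds the \<open>\<ell>\<^sup>1\<close> distance from the centre, hence also
  the Euclidean one.
\<close>

lemma KS_cube_in_ball:
  fixes x :: "nat \<Rightarrow> real^'n"
  assumes x: "range x = {q. \<forall>i. q $ i \<in> \<rat>}" and e: "0 < e"
  obtains k where "KS_cube x k \<subseteq> ball y e"
proof -
  obtain q where "\<And>i. q $ i \<in> \<rat>" "dist q y < e / 2"
    using rational_points_dense[of "e / 2"] e by auto
  then obtain i where i: "dist (x i) y < e / 2" 
  proof -
    have "q \<in> range x" unfolding x using \<open>\<And>i. q $ i \<in> \<rat>\<close> by simp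
    then show thesis using \<open>dist q y < e / 2\<close> that by auto
  qed
  have "0 < e / (2 * real CARD('n))" using e by simp
  then obtain l where l: "(1 / 2) ^ l < e / (2 * real CARD('n))"
    using real_arch_pow_inv[of _ "1/2"] by auto
  let ?h = "half_edge TYPE('n) l"
  have "?h \<le> (1 / 2) ^ l"
    using half_edge_le[where 'n='n, of l] half_edge_pos[where 'n='n, of l] by simp
  then have h: "real CARD('n) * ?h < e / 2"
  proof -
    have "?h < e / (2 * real CARD('n))" using \<open>?h \<le> (1 / 2) ^ l\<close> l by (rule le_less_trans)
    then show ?thesis by (simp add: field_simps)
  qed
  have "rcube x l i \<subseteq> ball y e"
  proof
    fix z assume "z \<in> rcube x l i"
    then have z: "\<bar>z $ j - x i $ j\<bar> \<le> ?h" for j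
      by (auto simp: rcube_eq mem_box_cart abs_le_iff algebra_simps dest!: spec[of _ j])
    have "dist z (x i) \<le> (\<Sum>j\<in>UNIV. \<bar>z $ j - x i $ j\<bar>)"
      using norm_le_l1_cart[of "z - x i"] by (simp add: dist_norm)
    also have "\<dots> \<le> real CARD('n) * ?h"
      using z by (intro sum_bounded_above) simp
    finally have "dist z y < e"
      using h i dist_triangle[of z y "x i"] by simp
    then show "z \<in> ball y e" by (simp add: dist_commute)
  qed
  then show thesis
    by (intro that[of "prod_encode (l, i)"]) (simp add: KS_cube_def)
qed

text \<open>
  If \<open>h y \<noteq> 0\<close>, then on a cube close to \<open>y\<close> the values of \<open>h\<close> differ from \<open>h y\<close> by less than
  \<open>norm (h y) / 2\<close>, so that the integral over the cube cannot vanish.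
\<close>

lemma continuous_zero_if_KS_coeffs_zero:
  fixes h :: "real^'n \<Rightarrow> 'k::{real_normed_field, euclidean_space}"
  assumes x: "range x = {q. \<forall>i. q $ i \<in> \<rat>}" and p: "1 \<le> p"
    and h: "h \<in> Lp p" "continuous_on UNIV h" and zero: "\<And>k. KS_coeff x k h = 0"
  shows "h y = 0"
proof (rule ccontr)
  assume ne: "h y \<noteq> 0"
  define e where "e = norm (h y) / 2"
  have e: "0 < e" using ne by (simp add: e_def)
  obtain d where d: "0 < d" "\<And>z. dist z y < d \<Longrightarrow> dist (h z) (h y) < e"
    using h(2) e unfolding continuous_on_iff by blast
  obtain k where k: "KS_cube x k \<subseteq> ball y d" using KS_cube_in_ball[OF x d(1)] .
  let ?I = "indicator (KS_cube x k) :: _ \<Rightarrow> real"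
  let ?m = "measure lebesgue (KS_cube x k)"
  have hi: "integrable lebesgue (\<lambda>z. ?I z *\<^sub>R h z)" by (rule Lp_cube_integrable(1)[OF p h(1)])
  have ci: "integrable lebesgue (\<lambda>z. ?I z *\<^sub>R h y)" by (rule integrable_const_on_cube)
  have cv: "(LINT z|lebesgue. ?I z *\<^sub>R h y) = ?m *\<^sub>R h y"
    by (rule integral_const_on_cube)
  have "?m * norm (h y) = norm (LINT z|lebesgue. ?I z *\<^sub>R h z - ?I z *\<^sub>R h y)"
    using zero[of k] hi ci cv by (simp add: KS_coeff_def)
  also have "\<dots> \<le> (LINT z|lebesgue. ?I z *\<^sub>R e)"
  proof (rule Bochner_Integration.integral_norm_bound_integral)
    show "integrable lebesgue (\<lambda>z. ?I z *\<^sub>R h z - ?I z *\<^sub>R h y)" using hi ci by simp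
    show "integrable lebesgue (\<lambda>z. ?I z *\<^sub>R e)" by (rule integrable_const_on_cube)
    fix z
    show "norm (?I z *\<^sub>R h z - ?I z *\<^sub>R h y) \<le> ?I z *\<^sub>R e"
      using d(2)[of z] k by (auto simp: indicator_def dist_norm norm_minus_commute subset_iff)
  qed
  also have "\<dots> = ?m * e"
    by (simp add: integral_const_on_cube)
  finally show False
    using KS_cube_measure(2)[of x k] e by (simp add: e_def)
qed

section \<open>The seminorm and its completion\<close>

locale KS_data = weighted_seq t p for t :: "nat \<Rightarrow> real" and p :: ennreal +
  fixes x :: "nat \<Rightarrow> real^'n"
  assumes x_rational: "range x = {q. \<forall>i. q $ i \<in> \<rat>}"
begin

text \<open>
  On \<open>Lp p\<close> this is only a pseudometric, since functions that agree almost everywhere have distance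
  0. All the arguments about the completion are phrased in terms of it.
\<close>

definition pdist :: "(real^'n \<Rightarrow> 'k::{real_normed_field, euclidean_space}) \<Rightarrow> (real^'n \<Rightarrow> 'k) \<Rightarrow> real" where
  "pdist f g = KS_norm x t p (\<lambda>y. f y - g y)"

lemma KS_norm_eq_wnorm: "KS_norm x t p f = wnorm t p (\<lambda>k. KS_coeff x k f)"
  by (simp add: KS_norm_def wnorm_def)

lemma Bseq_coeff: "f \<in> Lp p \<Longrightarrow> Bseq (\<lambda>k. KS_coeff x k f)"
  using Lp_cube_integrable(2)[OF p_ge_1] by (meson BseqI')

lemma Lp_diff: "f \<in> Lp p \<Longrightarrow> g \<in> Lp p \<Longrightarrow> (\<lambda>y. f y - g y) \<in> Lp p"
  using Lp_lincomb[of f p g 1 "-1"] by simp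

lemma Lp_scale: "f \<in> Lp p \<Longrightarrow> (\<lambda>y. c * f y) \<in> Lp p"
  using Lp_lincomb[of f p f c 0] by simp

lemma KS_norm_lincomb:
  fixes f g :: "real^'n \<Rightarrow> 'k::{real_normed_field, euclidean_space}"
  assumes "f \<in> Lp p" "g \<in> Lp p"
  shows "KS_norm x t p (\<lambda>y. c * f y + d * g y) \<le> norm c * KS_norm x t p f + norm d * KS_norm x t p g"
proof -
  have scaled: "Bseq (\<lambda>k. c * KS_coeff x k f)"
      "wnorm t p (\<lambda>k. c * KS_coeff x k f) \<le> norm c * KS_norm x t p f"
    if "f \<in> Lp p" for c :: 'k and f :: "real^'n \<Rightarrow> 'k"
  proof -
    show "Bseq (\<lambda>k. c * KS_coeff x k f)"
      using Bseq_coeff[OF Lp_scale[OF that, of c]] KS_coeff_lincomb[OF p_ge_1 that that, of x _ c 0]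
      by simp
    show "wnorm t p (\<lambda>k. c * KS_coeff x k f) \<le> norm c * KS_norm x t p f"
      unfolding KS_norm_eq_wnorm
      by (rule wnorm_dominated[OF Bseq_coeff[OF that]]) (auto simp: norm_mult)
  qed
  show ?thesis
    using wnorm_triangle[OF scaled(1)[OF assms(1), of c] scaled(1)[OF assms(2), of d]]
      scaled(2)[OF assms(1), of c] scaled(2)[OF assms(2), of d]
    by (simp add: KS_norm_eq_wnorm KS_coeff_lincomb[OF p_ge_1 assms])
qed

lemma pdist_nonneg: "f \<in> Lp p \<Longrightarrow> g \<in> Lp p \<Longrightarrow> 0 \<le> pdist f g"
  unfolding pdist_def KS_norm_eq_wnorm by (intro wnorm_nonneg Bseq_coeff Lp_diff)

text \<open>
  The joint Lipschitz estimate for linear combinations. It shows both that they preserve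
  Cauchy sequences and that they respect the equivalence of such sequences.
\<close>

lemma pdist_lincomb:
  assumes "f \<in> Lp p" "f' \<in> Lp p" "g \<in> Lp p" "g' \<in> Lp p"
  shows "pdist (\<lambda>y. c * f y + d * g y) (\<lambda>y. c * f' y + d * g' y) \<le> norm c * pdist f f' + norm d * pdist g g'"
proof -
  have "(\<lambda>y. (c * f y + d * g y) - (c * f' y + d * g' y))
      = (\<lambda>y. c * (f y - f' y) + d * (g y - g' y))"
    by (simp add: algebra_simps)
  then show ?thesis
    using KS_norm_lincomb[OF Lp_diff[OF assms(1,2)] Lp_diff[OF assms(3,4)], of c d]
    by (simp add: pdist_def)
qed

lemma pdist_triangle:
  assumes "f \<in> Lp p" "g \<in> Lp p" "h \<in> Lp p"
  shows "pdist f h \<le> pdist f g + pdist g h"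
  using KS_norm_lincomb[OF Lp_diff[OF assms(1,2)] Lp_diff[OF assms(2,3)], of 1 1]
  by (simp add: pdist_def)

lemma pdist_commute:
  fixes f g :: "real^'n \<Rightarrow> 'k::{real_normed_field, euclidean_space}"
  shows "f \<in> Lp p \<Longrightarrow> g \<in> Lp p \<Longrightarrow> pdist f g = pdist g f"
proof -
  have "pdist f g \<le> pdist g f" if "f \<in> Lp p" "g \<in> Lp p" for f g :: "real^'n \<Rightarrow> 'k"
    using KS_norm_lincomb[OF Lp_diff[OF that(2,1)] Lp_diff[OF that(2,1)], of "-1" 0]
    by (simp add: pdist_def)
  then show "f \<in> Lp p \<Longrightarrow> g \<in> Lp p \<Longrightarrow> pdist f g = pdist g f" by (intro order_antisym)
qed

lemma pdist_refl:
  fixes f :: "real^'n \<Rightarrow> 'k::{real_normed_field, euclidean_space}"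
  shows "pdist f f = 0"
proof (rule order_antisym)
  have "pdist f f = wnorm t p (\<lambda>_. 0 :: 'k)"
    by (simp add: pdist_def KS_norm_eq_wnorm KS_coeff_def)
  then show "pdist f f \<le> 0" "0 \<le> pdist f f"
    using wnorm_le_bound[of "\<lambda>_. 0 :: 'k" 0] wnorm_nonneg[of "\<lambda>_. 0 :: 'k"] by simp_all
qed

text \<open>
  This bound of the norm by the supremum norm is the source of the continuity of the embedding.
\<close>

lemma pdist_le_sup:
  assumes "\<And>y. norm (f y - g y) \<le> C"
  shows "pdist f g \<le> C"
  unfolding pdist_def KS_norm_eq_wnorm by (intro wnorm_le_bound KS_coeff_le_sup assms)

lemma pdist_eq_0_continuous:
  assumes "f \<in> Lp p" "g \<in> Lp p" "continuous_on UNIV f" "continuous_on UNIV g" "pdist f g = 0"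
  shows "f = g"
proof
  fix y
  have "KS_coeff x k (\<lambda>y. f y - g y) = 0" for k
    using wnorm_eq_0D[OF Bseq_coeff[OF Lp_diff[OF assms(1,2)]]] assms(5)
    by (simp add: pdist_def KS_norm_eq_wnorm)
  then have "f y - g y = 0"
    by (rule continuous_zero_if_KS_coeffs_zero[OF x_rational p_ge_1 Lp_diff[OF assms(1,2)]
        continuous_on_diff[OF assms(3,4)]])
  then show "f y = g y" by simp
qed

lemma KS_Cauchy_iff:
  "S \<in> KS_Cauchy x t p \<longleftrightarrow>
    (\<forall>j. S j \<in> Lp p) \<and> (\<forall>e>0. \<exists>N. \<forall>m\<ge>N. \<forall>n\<ge>N. pdist (S m) (S n) < e)"
  by (simp add: KS_Cauchy_def pdist_def)

lemma KS_rel_iff: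
  "(S, T) \<in> KS_rel x t p \<longleftrightarrow> S \<in> KS_Cauchy x t p \<and> T \<in> KS_Cauchy x t p \<and>
     (\<lambda>j. pdist (S j) (T j)) \<longlonglongrightarrow> 0"
  by (simp add: KS_rel_def pdist_def)

lemma KS_Cauchy_Lp: "S \<in> KS_Cauchy x t p \<Longrightarrow> S j \<in> Lp p"
  by (simp add: KS_Cauchy_def)

lemma const_Cauchy: "f \<in> Lp p \<Longrightarrow> (\<lambda>_. f) \<in> KS_Cauchy x t p"
  by (simp add: KS_Cauchy_iff pdist_refl)

lemma tendsto_0_dominated:
  fixes u v :: "nat \<Rightarrow> real"
  assumes "v \<longlonglongrightarrow> 0" "\<And>j. 0 \<le> u j" "\<And>j. u j \<le> v j"
  shows "u \<longlonglongrightarrow> 0"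
  by (rule tendsto_sandwich[OF _ _ tendsto_const assms(1)]) (use assms in auto)

lemma equiv_KS_rel: "equiv (KS_Cauchy x t p) (KS_rel x t p)"
proof (rule equivI)
  show "KS_rel x t p \<subseteq> KS_Cauchy x t p \<times> KS_Cauchy x t p" by (auto simp: KS_rel_def)
  show "refl_on (KS_Cauchy x t p) (KS_rel x t p)"
    by (auto simp: refl_on_def KS_rel_iff pdist_refl)
  show "sym (KS_rel x t p)"
    by (auto simp: sym_def KS_rel_iff pdist_commute KS_Cauchy_Lp)
  show "trans (KS_rel x t p)"
  proof (rule transI)
    fix S T U assume *: "(S, T) \<in> KS_rel x t p" "(T, U) \<in> KS_rel x t p"
    then have C: "S \<in> KS_Cauchy x t p" "T \<in> KS_Cauchy x t p" "U \<in> KS_Cauchy x t p"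
      and lim: "(\<lambda>j. pdist (S j) (T j) + pdist (T j) (U j)) \<longlonglongrightarrow> 0"
      using tendsto_add[of _ 0 _ _ 0] by (auto simp: KS_rel_iff)
    show "(S, U) \<in> KS_rel x t p"
      using C tendsto_0_dominated[OF lim]
      by (simp add: KS_rel_iff KS_Cauchy_Lp pdist_nonneg pdist_triangle)
  qed
qed

lemma KS_Cauchy_lincomb:
  assumes S: "S \<in> KS_Cauchy x t p" and T: "T \<in> KS_Cauchy x t p"
  shows "(\<lambda>j y. c * S j y + d * T j y) \<in> KS_Cauchy x t p"
  unfolding KS_Cauchy_iff
proof (intro conjI allI impI)
  show "(\<lambda>y. c * S j y + d * T j y) \<in> Lp p" for j
    using S T by (intro Lp_lincomb KS_Cauchy_Lp)
  fix e :: real assume e: "0 < e"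
  \<comment> \<open>The summand 1 keeps \<open>M\<close> positive when both scalars are 0.\<close>
  define M where "M = norm c + norm d + 1"
  have M: "0 < M" by (simp add: M_def add_nonneg_pos)
  obtain N1 where N1: "\<And>m n. m \<ge> N1 \<Longrightarrow> n \<ge> N1 \<Longrightarrow> pdist (S m) (S n) < e / M"
    using S e M unfolding KS_Cauchy_iff by (meson divide_pos_pos)
  obtain N2 where N2: "\<And>m n. m \<ge> N2 \<Longrightarrow> n \<ge> N2 \<Longrightarrow> pdist (T m) (T n) < e / M"
    using T e M unfolding KS_Cauchy_iff by (meson divide_pos_pos)
  show "\<exists>N. \<forall>m\<ge>N. \<forall>n\<ge>N.
      pdist (\<lambda>y. c * S m y + d * T m y) (\<lambda>y. c * S n y + d * T n y) < e"
  proof (intro exI[of _ "max N1 N2"] allI impI)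
    fix m n assume mn: "max N1 N2 \<le> m" "max N1 N2 \<le> n"
    have "pdist (\<lambda>y. c * S m y + d * T m y) (\<lambda>y. c * S n y + d * T n y)
        \<le> norm c * pdist (S m) (S n) + norm d * pdist (T m) (T n)"
      using S T by (intro pdist_lincomb KS_Cauchy_Lp)
    also have "\<dots> \<le> norm c * (e / M) + norm d * (e / M)"
      using N1[of m n] N2[of m n] mn by (intro add_mono mult_left_mono) auto
    also have "\<dots> < M * (e / M)"
    proof -
      have "norm c * (e / M) + norm d * (e / M) = (M - 1) * (e / M)"
        unfolding M_def by (simp only: distrib_right add_diff_cancel_right')
      also have "\<dots> < M * (e / M)" using e M by (intro mult_strict_right_mono) auto
      finally show ?thesis .
    qed
    finally show "pdist (\<lambda>y. c * S m y + d * T m y) (\<lambda>y. c * S n y + d * T n y) < e"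
      using M by simp
  qed
qed

lemma KS_rel_lincomb:
  assumes S: "(S, S') \<in> KS_rel x t p" and T: "(T, T') \<in> KS_rel x t p"
  shows "((\<lambda>j y. c * S j y + d * T j y), (\<lambda>j y. c * S' j y + d * T' j y)) \<in> KS_rel x t p"
proof -
  have C: "S \<in> KS_Cauchy x t p" "S' \<in> KS_Cauchy x t p" "T \<in> KS_Cauchy x t p" "T' \<in> KS_Cauchy x t p"
    using S T by (auto simp: KS_rel_iff)
  have "(\<lambda>j. norm c * pdist (S j) (S' j) + norm d * pdist (T j) (T' j)) \<longlonglongrightarrow> norm c * 0 + norm d * 0"
    using S T by (intro tendsto_intros) (auto simp: KS_rel_iff)
  then have lim: "(\<lambda>j. norm c * pdist (S j) (S' j) + norm d * pdist (T j) (T' j)) \<longlonglongrightarrow> 0" by simp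
  show ?thesis
    unfolding KS_rel_iff using C
    by (intro conjI KS_Cauchy_lincomb tendsto_0_dominated[OF lim] pdist_nonneg pdist_lincomb
        Lp_lincomb KS_Cauchy_Lp)
qed

lemma KS_add_class:
  assumes S: "S \<in> KS_Cauchy x t p" and T: "T \<in> KS_Cauchy x t p"
  shows "KS_add x t p (KS_rel x t p `` {S}) (KS_rel x t p `` {T})
       = KS_rel x t p `` {\<lambda>j y. S j y + T j y}"
  unfolding KS_add_def
proof (rule UN_equiv_class2[OF equiv_KS_rel equiv_KS_rel _ S T])
  show "congruent2 (KS_rel x t p) (KS_rel x t p) (\<lambda>S T. KS_rel x t p `` {\<lambda>j y. S j y + T j y})"
    using KS_rel_lincomb[of _ _ _ _ 1 1]
    by (auto simp: congruent2_def intro!: equiv_class_eq[OF equiv_KS_rel])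
qed

lemma KS_scale_class:
  assumes S: "S \<in> KS_Cauchy x t p"
  shows "KS_scale x t p c (KS_rel x t p `` {S}) = KS_rel x t p `` {\<lambda>j y. c * S j y}"
  unfolding KS_scale_def
proof (rule UN_equiv_class[OF equiv_KS_rel _ S])
  show "congruent (KS_rel x t p) (\<lambda>S. KS_rel x t p `` {\<lambda>j y. c * S j y})"
    using KS_rel_lincomb[of _ _ _ _ c 0]
    by (auto simp: congruent_def intro!: equiv_class_eq[OF equiv_KS_rel])
qed

lemma pdist_Cauchy_convergent:
  assumes S: "S \<in> KS_Cauchy x t p" and T: "T \<in> KS_Cauchy x t p"
  shows "convergent (\<lambda>j. pdist (S j) (T j))"
proof (rule Cauchy_convergent, rule CauchyI)
  fix e :: real assume e: "0 < e"
  obtain N1 where N1: "\<And>m n. m \<ge> N1 \<Longrightarrow> n \<ge> N1 \<Longrightarrow> pdist (S m) (S n) < e / 2"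
    using S e unfolding KS_Cauchy_iff by (meson half_gt_zero)
  obtain N2 where N2: "\<And>m n. m \<ge> N2 \<Longrightarrow> n \<ge> N2 \<Longrightarrow> pdist (T m) (T n) < e / 2"
    using T e unfolding KS_Cauchy_iff by (meson half_gt_zero)
  have le: "pdist (S m) (T m) - pdist (S n) (T n) \<le> pdist (S m) (S n) + pdist (T n) (T m)" for m n
    using pdist_triangle[OF KS_Cauchy_Lp[OF S, of m] KS_Cauchy_Lp[OF S, of n] KS_Cauchy_Lp[OF T, of m]]
      pdist_triangle[OF KS_Cauchy_Lp[OF S, of n] KS_Cauchy_Lp[OF T, of n] KS_Cauchy_Lp[OF T, of m]]
    by linarith
  show "\<exists>N. \<forall>m\<ge>N. \<forall>n\<ge>N. norm (pdist (S m) (T m) - pdist (S n) (T n)) < e"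
  proof (intro exI[of _ "max N1 N2"] allI impI)
    fix m n assume mn: "max N1 N2 \<le> m" "max N1 N2 \<le> n"
    show "norm (pdist (S m) (T m) - pdist (S n) (T n)) < e"
      using le[of m n] le[of n m] N1[of m n] N1[of n m] N2[of m n] N2[of n m] mn by auto
  qed
qed

text \<open>
  By the quadrilateral inequality, replacing \<open>S\<close> and \<open>T\<close> by equivalent sequences changes the distances
  \<open>pdist (S j) (T j)\<close> by a null sequence.
\<close>

lemma pdist_limit_respects_rel:
  assumes S: "(S, S') \<in> KS_rel x t p" and T: "(T, T') \<in> KS_rel x t p"
    and lim: "(\<lambda>j. pdist (S j) (T j)) \<longlonglongrightarrow> l"
  shows "(\<lambda>j. pdist (S' j) (T' j)) \<longlonglongrightarrow> l"
proof -
  have C: "S j \<in> Lp p" "S' j \<in> Lp p" "T j \<in> Lp p" "T' j \<in> Lp p" for j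
    using S T by (auto simp: KS_rel_iff KS_Cauchy_Lp)
  have "(\<lambda>j. pdist (S j) (S' j) + pdist (T j) (T' j)) \<longlonglongrightarrow> 0 + 0"
    using S T by (intro tendsto_add) (auto simp: KS_rel_iff)
  then have sum0: "(\<lambda>j. pdist (S j) (S' j) + pdist (T j) (T' j)) \<longlonglongrightarrow> 0" by simp
  have close: "\<bar>pdist (S' j) (T' j) - pdist (S j) (T j)\<bar> \<le> pdist (S j) (S' j) + pdist (T j) (T' j)" for j
    using pdist_triangle[OF C(2)[of j] C(1)[of j] C(4)[of j]]
      pdist_triangle[OF C(1)[of j] C(3)[of j] C(4)[of j]]
      pdist_triangle[OF C(1)[of j] C(2)[of j] C(3)[of j]]
      pdist_triangle[OF C(2)[of j] C(4)[of j] C(3)[of j]]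
      pdist_commute[OF C(1)[of j] C(2)[of j]] pdist_commute[OF C(3)[of j] C(4)[of j]]
    by linarith
  have "(\<lambda>j. \<bar>pdist (S' j) (T' j) - pdist (S j) (T j)\<bar>) \<longlonglongrightarrow> 0"
    by (rule tendsto_0_dominated[OF sum0 abs_ge_zero close])
  then have "(\<lambda>j. pdist (S' j) (T' j) - pdist (S j) (T j)) \<longlonglongrightarrow> 0"
    by (rule tendsto_rabs_zero_cancel)
  from tendsto_add[OF this lim] show ?thesis by simp
qed

text \<open>
  The definite description in \<open>KS_dist\<close> denotes: the limit exists by completeness of the reals and
  is the same for all representatives.
\<close>

lemma KS_dist_class:
  assumes S: "S \<in> KS_Cauchy x t p" and T: "T \<in> KS_Cauchy x t p"
  shows "(\<lambda>j. pdist (S j) (T j)) \<longlonglongrightarrow> KS_dist x t p (KS_rel x t p `` {S}) (KS_rel x t p `` {T})"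
proof -
  obtain l where l: "(\<lambda>j. pdist (S j) (T j)) \<longlonglongrightarrow> l"
    using pdist_Cauchy_convergent[OF S T] by (auto simp: convergent_def)
  let ?X = "KS_rel x t p `` {S}" and ?Y = "KS_rel x t p `` {T}"
  have mem: "?X \<in> KS_space x t p" "?Y \<in> KS_space x t p"
    using S T by (auto simp: KS_space_def quotientI)
  have self: "S \<in> ?X" "T \<in> ?Y"
    using S T equiv_class_self[OF equiv_KS_rel] by auto
  have "(THE d. \<forall>S\<in>?X. \<forall>T\<in>?Y. (\<lambda>j. pdist (S j) (T j)) \<longlonglongrightarrow> d) = l"
  proof (rule the_equality)
    show "\<forall>S\<in>?X. \<forall>T\<in>?Y. (\<lambda>j. pdist (S j) (T j)) \<longlonglongrightarrow> l"
      using pdist_limit_respects_rel[OF _ _ l] by auto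
  next
    fix d assume "\<forall>S\<in>?X. \<forall>T\<in>?Y. (\<lambda>j. pdist (S j) (T j)) \<longlonglongrightarrow> d"
    then have "(\<lambda>j. pdist (S j) (T j)) \<longlonglongrightarrow> d" using self by blast
    then show "d = l" using l by (rule LIMSEQ_unique)
  qed
  then have "KS_dist x t p ?X ?Y = l"
    using mem by (simp add: KS_dist_def pdist_def)
  then show ?thesis using l by simp
qed

lemma KS_space_cases:
  assumes "X \<in> KS_space x t p"
  obtains S where "X = KS_rel x t p `` {S}" "S \<in> KS_Cauchy x t p"
  using assms unfolding KS_space_def by (rule quotientE)

lemma KS_dist_eq_0_off: "X \<notin> KS_space x t p \<or> Y \<notin> KS_space x t p \<Longrightarrow> KS_dist x t p X Y = 0"
  by (auto simp: KS_dist_def)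

lemma Metric_space_KS:
  "Metric_space (KS_space x t p :: (nat \<Rightarrow> real^'n \<Rightarrow> 'k::{real_normed_field, euclidean_space}) set set)
     (KS_dist x t p)"
proof
  fix X Y :: "(nat \<Rightarrow> real^'n \<Rightarrow> 'k) set"
  show "0 \<le> KS_dist x t p X Y"
  proof (cases "X \<in> KS_space x t p \<and> Y \<in> KS_space x t p")
    case True
    from conjunct1[OF True] obtain S where S: "X = KS_rel x t p `` {S}" "S \<in> KS_Cauchy x t p"
      by (rule KS_space_cases)
    from conjunct2[OF True] obtain T where T: "Y = KS_rel x t p `` {T}" "T \<in> KS_Cauchy x t p"
      by (rule KS_space_cases)
    then show ?thesis
      unfolding S(1) T(1) using S(2) T(2)
      by (intro LIMSEQ_le_const[OF KS_dist_class] exI[of _ 0] allI impI pdist_nonneg KS_Cauchy_Lp)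
  qed (auto simp: KS_dist_eq_0_off)
  show "KS_dist x t p X Y = KS_dist x t p Y X"
  proof (cases "X \<in> KS_space x t p \<and> Y \<in> KS_space x t p")
    case True
    from conjunct1[OF True] obtain S where S: "X = KS_rel x t p `` {S}" "S \<in> KS_Cauchy x t p"
      by (rule KS_space_cases)
    from conjunct2[OF True] obtain T where T: "Y = KS_rel x t p `` {T}" "T \<in> KS_Cauchy x t p"
      by (rule KS_space_cases)
    have "(\<lambda>j. pdist (S j) (T j)) = (\<lambda>j. pdist (T j) (S j))"
      using S(2) T(2) by (intro ext pdist_commute KS_Cauchy_Lp)
    then show ?thesis
      unfolding S(1) T(1)
      using LIMSEQ_unique[OF KS_dist_class[OF S(2) T(2)]] KS_dist_class[OF T(2) S(2)] by simp
  qed (auto simp: KS_dist_eq_0_off)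
next
  fix X Y :: "(nat \<Rightarrow> real^'n \<Rightarrow> 'k) set"
  assume X: "X \<in> KS_space x t p" and Y: "Y \<in> KS_space x t p"
  obtain S where S: "X = KS_rel x t p `` {S}" "S \<in> KS_Cauchy x t p"
    using X by (rule KS_space_cases)
  obtain T where T: "Y = KS_rel x t p `` {T}" "T \<in> KS_Cauchy x t p"
    using Y by (rule KS_space_cases)
  have "KS_dist x t p X Y = 0 \<longleftrightarrow> (\<lambda>j. pdist (S j) (T j)) \<longlonglongrightarrow> 0"
    unfolding S(1) T(1)
    using LIMSEQ_unique[OF KS_dist_class[OF S(2) T(2)], of 0] KS_dist_class[OF S(2) T(2)] by auto
  also have "\<dots> \<longleftrightarrow> X = Y"
    using S(2) T(2) unfolding S(1) T(1) eq_equiv_class_iff[OF equiv_KS_rel S(2) T(2)] KS_rel_iff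
    by blast
  finally show "KS_dist x t p X Y = 0 \<longleftrightarrow> X = Y" .
next
  fix X Y Z :: "(nat \<Rightarrow> real^'n \<Rightarrow> 'k) set"
  assume X: "X \<in> KS_space x t p" and Y: "Y \<in> KS_space x t p" and Z: "Z \<in> KS_space x t p"
  obtain S where S: "X = KS_rel x t p `` {S}" "S \<in> KS_Cauchy x t p"
    using X by (rule KS_space_cases)
  obtain T where T: "Y = KS_rel x t p `` {T}" "T \<in> KS_Cauchy x t p"
    using Y by (rule KS_space_cases)
  obtain U where U: "Z = KS_rel x t p `` {U}" "U \<in> KS_Cauchy x t p"
    using Z by (rule KS_space_cases)
  show "KS_dist x t p X Z \<le> KS_dist x t p X Y + KS_dist x t p Y Z"
    unfolding S(1) T(1) U(1)
  proof (rule LIMSEQ_le)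
    show "(\<lambda>j. pdist (S j) (U j)) \<longlonglongrightarrow> KS_dist x t p (KS_rel x t p `` {S}) (KS_rel x t p `` {U})"
      by (rule KS_dist_class[OF S(2) U(2)])
    show "(\<lambda>j. pdist (S j) (T j) + pdist (T j) (U j)) \<longlonglongrightarrow>
        KS_dist x t p (KS_rel x t p `` {S}) (KS_rel x t p `` {T})
      + KS_dist x t p (KS_rel x t p `` {T}) (KS_rel x t p `` {U})"
      by (rule tendsto_add[OF KS_dist_class[OF S(2) T(2)] KS_dist_class[OF T(2) U(2)]])
    show "\<exists>N. \<forall>j\<ge>N. pdist (S j) (U j) \<le> pdist (S j) (T j) + pdist (T j) (U j)"
      using pdist_triangle[OF KS_Cauchy_Lp[OF S(2)] KS_Cauchy_Lp[OF T(2)] KS_Cauchy_Lp[OF U(2)]]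
      by blast
  qed
qed

lemma KS_embed_in_space: "f \<in> Lp p \<Longrightarrow> KS_embed x t p f \<in> KS_space x t p"
  unfolding KS_embed_def KS_space_def by (intro quotientI const_Cauchy)

lemma KS_dist_embed:
  assumes "f \<in> Lp p" "g \<in> Lp p"
  shows "KS_dist x t p (KS_embed x t p f) (KS_embed x t p g) = pdist f g"
  using KS_dist_class[OF const_Cauchy[OF assms(1)] const_Cauchy[OF assms(2)]]
  unfolding KS_embed_def by (simp add: LIMSEQ_const_iff)

lemma KS_embed_add:
  assumes "f \<in> Lp p" "g \<in> Lp p"
  shows "KS_embed x t p (\<lambda>y. f y + g y) = KS_add x t p (KS_embed x t p f) (KS_embed x t p g)"
  unfolding KS_embed_def by (simp add: KS_add_class const_Cauchy assms)

lemma KS_embed_scale: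
  assumes "f \<in> Lp p"
  shows "KS_embed x t p (\<lambda>y. c * f y) = KS_scale x t p c (KS_embed x t p f)"
  unfolding KS_embed_def by (simp add: KS_scale_class const_Cauchy assms)

lemma KS_embed_eq_continuous:
  fixes f g :: "real^'n \<Rightarrow> 'k::{real_normed_field, euclidean_space}"
  assumes "f \<in> Lp p" "g \<in> Lp p" "continuous_on UNIV f" "continuous_on UNIV g"
    and "KS_embed x t p f = KS_embed x t p g"
  shows "f = g"
proof (rule pdist_eq_0_continuous[OF assms(1-4)])
  interpret Metric_space "KS_space x t p :: (nat \<Rightarrow> real^'n \<Rightarrow> 'k) set set" "KS_dist x t p"
    by (rule Metric_space_KS)
  show "pdist f g = 0"
    using zero[OF KS_embed_in_space KS_embed_in_space, OF assms(2,2)]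
    unfolding KS_dist_embed[OF assms(1,2), symmetric] assms(5) by blast
qed

end

section \<open>Test functions\<close>

lemma test_function_continuous: "f \<in> test_functions \<Longrightarrow> continuous_on UNIV f"
proof -
  assume "f \<in> test_functions"
  then have "continuous_on UNIV (mderiv [] f)"
    unfolding test_functions_def smooth_def by blast
  then show ?thesis by simp
qed

lemma not_in_fsupport: "y \<notin> fsupport f \<Longrightarrow> f y = 0"
  unfolding fsupport_def using closure_subset[of "{y. f y \<noteq> 0}"] by auto

lemma test_function_bounded:
  assumes "f \<in> test_functions"
  obtains C where "\<And>y. norm (f y) \<le> C"
proof -
  have "compact (f ` fsupport f)"
    using assms continuous_on_subset[OF test_function_continuous[OF assms]]
    by (intro compact_continuous_image) (auto simp: test_functions_def)
  then obtain C where C: "\<And>y. y \<in> fsupport f \<Longrightarrow> norm (f y) \<le> C"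
    using compact_imp_bounded[of "f ` fsupport f"] by (auto simp: bounded_iff)
  show thesis
  proof (rule that)
    show "norm (f y) \<le> max C 0" for y
      using C[of y] not_in_fsupport[of y f] by (cases "y \<in> fsupport f") auto
  qed
qed

lemma test_functions_subset_Lp:
  "(test_functions :: (real^'n \<Rightarrow> 'k::{real_normed_field, euclidean_space}) set) \<subseteq> Lp p"
proof
  fix f :: "real^'n \<Rightarrow> 'k" assume f: "f \<in> test_functions"
  obtain C where C: "\<And>y. norm (f y) \<le> C" using test_function_bounded[OF f] by blast
  have m [measurable]: "f \<in> borel_measurable lebesgue"
    using measurable_completion[of f lborel borel]
      borel_measurable_continuous_onI[OF test_function_continuous[OF f]] by simp
  have K: "fsupport f \<in> lmeasurable"
    using f by (simp add: test_functions_def lmeasurable_compact)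
  let ?q = "enn2real p"
  have "integrable lebesgue (\<lambda>y. norm (f y) powr ?q)"
  proof (rule Bochner_Integration.integrable_bound)
    show "integrable lebesgue (\<lambda>y. C powr ?q * indicator (fsupport f) y)"
      using K by (intro integrable_mult_right)
        (simp add: fmeasurable_def integrable_indicator_iff del: emeasure_completion)
    show "(\<lambda>y. norm (f y) powr ?q) \<in> borel_measurable lebesgue" by measurable
    show "AE y in lebesgue. norm (norm (f y) powr ?q) \<le> norm (C powr ?q * indicator (fsupport f) y)"
      using C not_in_fsupport[of _ f] by (auto simp: indicator_def intro!: AE_I2 powr_mono2)
  qed
  then show "f \<in> Lp p" using C by (auto simp: Lp_def)
qed

text \<open>
  Smoothness is assumed because \<open>vector_derivative\<close> is linear only where the derivatives exist.
\<close>

lemma mderiv_lincomb: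
  fixes f g :: "real^'n \<Rightarrow> 'k::{real_normed_field, euclidean_space}"
  assumes f: "smooth f" and g: "smooth g"
  shows "mderiv \<alpha> (\<lambda>y. a * f y + b * g y) = (\<lambda>y. a * mderiv \<alpha> f y + b * mderiv \<alpha> g y)"
proof (induction \<alpha>)
  case Nil
  then show ?case by simp
next
  case (Cons i \<alpha>)
  show ?case
  proof
    fix y
    have "((\<lambda>h. mderiv \<alpha> u (y + h *\<^sub>R axis i 1)) has_vector_derivative mderiv (i # \<alpha>) u y) (at 0)"
      if "smooth u" for u :: "real^'n \<Rightarrow> 'k"
      using that by (simp add: smooth_def partial_deriv_def vector_derivative_works[symmetric])
    from this[OF f] this[OF g]
    have "((\<lambda>h. a * mderiv \<alpha> f (y + h *\<^sub>R axis i 1) + b * mderiv \<alpha> g (y + h *\<^sub>R axis i 1))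
        has_vector_derivative a * mderiv (i # \<alpha>) f y + b * mderiv (i # \<alpha>) g y) (at 0)"
      by (intro has_vector_derivative_add has_vector_derivative_mult_right)
    then show "mderiv (i # \<alpha>) (\<lambda>y. a * f y + b * g y) y
        = a * mderiv (i # \<alpha>) f y + b * mderiv (i # \<alpha>) g y"
      unfolding mderiv.simps(2)[of i \<alpha> "\<lambda>y. a * f y + b * g y"] Cons.IH partial_deriv_def
      by (rule vector_derivative_at)
  qed
qed

lemma test_functions_lincomb:
  fixes f g :: "real^'n \<Rightarrow> 'k::{real_normed_field, euclidean_space}"
  assumes f: "f \<in> test_functions" and g: "g \<in> test_functions"
  shows "(\<lambda>y. a * f y + b * g y) \<in> test_functions"
proof -
  have sm: "smooth f" "smooth g" using f g by (auto simp: test_functions_def)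
  have "smooth (\<lambda>y. a * f y + b * g y)"
    unfolding smooth_def mderiv_lincomb[OF sm]
  proof (intro allI conjI)
    fix \<alpha> i y
    show "continuous_on UNIV (\<lambda>y. a * mderiv \<alpha> f y + b * mderiv \<alpha> g y)"
      using sm by (intro continuous_intros) (simp_all add: smooth_def)
    show "(\<lambda>h. a * mderiv \<alpha> f (y + h *\<^sub>R axis i 1) + b * mderiv \<alpha> g (y + h *\<^sub>R axis i 1))
        differentiable (at 0)"
      using sm by (intro differentiable_add differentiable_mult differentiable_const)
        (simp_all add: smooth_def)
  qed
  moreover have "compact (fsupport (\<lambda>y. a * f y + b * g y))"
  proof -
    have K: "compact (fsupport f \<union> fsupport g)"
      using f g by (auto simp: test_functions_def)
    have "{y. a * f y + b * g y \<noteq> 0} \<subseteq> fsupport f \<union> fsupport g"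
      using not_in_fsupport[of _ f] not_in_fsupport[of _ g] by fastforce
    then have "fsupport (\<lambda>y. a * f y + b * g y) \<subseteq> fsupport f \<union> fsupport g"
      unfolding fsupport_def[of "\<lambda>y. a * f y + b * g y"]
      using K by (intro closure_minimal compact_imp_closed)
    then have "fsupport (\<lambda>y. a * f y + b * g y)
        = (fsupport f \<union> fsupport g) \<inter> fsupport (\<lambda>y. a * f y + b * g y)" by blast
    moreover have "closed (fsupport (\<lambda>y. a * f y + b * g y))" by (simp add: fsupport_def)
    ultimately show ?thesis using compact_Int_closed[OF K] by metis
  qed
  ultimately show ?thesis by (simp add: test_functions_def)
qed

text \<open>
  Used to see that the whole space of test functions is open, so that it is the carrier of
  \<open>tf_topology\<close>.
\<close>

lemma tf_zero_nbhd_test_functions: "tf_zero_nbhd test_functions"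
  unfolding tf_zero_nbhd_def by (auto intro: test_functions_lincomb exI[of _ 1])

text \<open>
  The set is absolutely convex, and the seminorm of order \<open>m = 0\<close> is the supremum norm, so
  \<open>m = 0\<close> and \<open>\<epsilon> = e\<close> serve for every compact set.
\<close>

lemma tf_zero_nbhd_sup_ball:
  assumes e: "0 < e"
  shows "tf_zero_nbhd {f \<in> (test_functions ::
    (real^'n \<Rightarrow> 'k::{real_normed_field, euclidean_space}) set). \<forall>y. norm (f y) \<le> e}" (is "tf_zero_nbhd ?V")
proof -
  have conv: "norm (a * f + b * g) \<le> e" if "norm a + norm b \<le> 1" "norm f \<le> e" "norm g \<le> e" for a b f g :: 'k
  proof -
    have "norm (a * f + b * g) \<le> norm a * e + norm b * e"
      using that by (intro norm_triangle_le add_mono) (auto simp: norm_mult intro: mult_left_mono)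
    also have "\<dots> \<le> e"
      using that(1) e mult_right_mono[of "norm a + norm b" 1 e] by (simp add: algebra_simps)
    finally show ?thesis .
  qed
  show ?thesis
    unfolding tf_zero_nbhd_def
  proof (intro conjI ballI allI impI)
    fix K :: "(real^'n) set" assume "compact K"
    show "\<exists>m. \<exists>\<epsilon>>0. \<forall>f\<in>test_functions. fsupport f \<subseteq> K \<longrightarrow>
        (\<forall>\<alpha> y. length \<alpha> \<le> m \<longrightarrow> norm (mderiv \<alpha> f y) < \<epsilon>) \<longrightarrow>
        f \<in> ?V"
    proof (intro exI[of _ "0::nat"] exI[of _ e] conjI ballI impI)
      fix f :: "real^'n \<Rightarrow> 'k"
      assume f: "f \<in> test_functions"
        and small: "\<forall>\<alpha> y. length \<alpha> \<le> 0 \<longrightarrow> norm (mderiv \<alpha> f y) < e"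
      have "norm (f y) < e" for y using small[rule_format, of "[]" y] by simp
      then show "f \<in> ?V"
        using f by (simp add: less_imp_le)
    qed (rule e)
  qed (auto intro: test_functions_lincomb conv)
qed

lemma topspace_tf_topology:
  "topspace tf_topology = (test_functions :: (real^'n \<Rightarrow> 'k::{real_normed_field, euclidean_space}) set)"
proof (rule antisym)
  have "openin tf_topology (topspace (tf_topology :: (real^'n \<Rightarrow> 'k) topology))" by simp
  then show "topspace tf_topology \<subseteq> (test_functions :: (real^'n \<Rightarrow> 'k) set)"
    unfolding openin_tf_topology by blast
  have "(\<lambda>y. f y + g y) \<in> test_functions"
    if "f \<in> test_functions" "g \<in> test_functions" for f g :: "real^'n \<Rightarrow> 'k"
    using test_functions_lincomb[OF that, of 1 1] by simp
  then have "openin tf_topology (test_functions :: (real^'n \<Rightarrow> 'k) set)"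
    unfolding openin_tf_topology using tf_zero_nbhd_test_functions by blast
  then show "(test_functions :: (real^'n \<Rightarrow> 'k) set) \<subseteq> topspace tf_topology" by (rule openin_subset)
qed

section \<open>The embedding\<close>

context KS_data
begin

lemma test_functions_Lp: "f \<in> test_functions \<Longrightarrow> f \<in> Lp p"
  using test_functions_subset_Lp by blast

lemma KS_embed_continuous_map:
  "continuous_map tf_topology (KS_topology x t p)
     (KS_embed x t p :: (real^'n \<Rightarrow> 'k::{real_normed_field, euclidean_space}) \<Rightarrow> _)"
proof -
  interpret Metric_space "KS_space x t p :: (nat \<Rightarrow> real^'n \<Rightarrow> 'k) set set" "KS_dist x t p"
    by (rule Metric_space_KS)
  show ?thesis
    unfolding continuous_map KS_topology_def topspace_tf_topology topspace_mtopology
  proof (intro conjI allI impI)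
    show "KS_embed x t p ` (test_functions :: (real^'n \<Rightarrow> 'k) set) \<subseteq> KS_space x t p"
      by (auto intro: KS_embed_in_space test_functions_Lp)
    fix U :: "(nat \<Rightarrow> real^'n \<Rightarrow> 'k) set set" assume U: "openin mtopology U"
    let ?P = "{f \<in> test_functions. KS_embed x t p f \<in> U}"
    have "\<exists>V. tf_zero_nbhd V \<and> (\<forall>g\<in>V. (\<lambda>y. f y + g y) \<in> ?P)" if f: "f \<in> ?P" for f
    proof -
      obtain r where r: "0 < r" "mball (KS_embed x t p f) r \<subseteq> U"
        using U f unfolding openin_mtopology by auto
      show ?thesis
      proof (intro exI conjI ballI)
        show "tf_zero_nbhd {g \<in> test_functions. \<forall>y. norm (g y :: 'k) \<le> r / 2}"
          using r(1) by (intro tf_zero_nbhd_sup_ball) simp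
        fix g :: "real^'n \<Rightarrow> 'k" assume g: "g \<in> {g \<in> test_functions. \<forall>y. norm (g y) \<le> r / 2}"
        have fg: "(\<lambda>y. f y + g y) \<in> test_functions"
          using test_functions_lincomb[of f g 1 1] f g by simp
        have "pdist f (\<lambda>y. f y + g y) \<le> r / 2" using g by (intro pdist_le_sup) simp
        then have "KS_embed x t p (\<lambda>y. f y + g y) \<in> mball (KS_embed x t p f) r"
          using f fg r(1) by (simp add: KS_embed_in_space KS_dist_embed test_functions_Lp)
        then show "(\<lambda>y. f y + g y) \<in> ?P" using fg r(2) by blast
      qed
    qed
    then show "openin tf_topology ?P" unfolding openin_tf_topology by blast
  qed
qed

text \<open>
  Outside the common compact set the differences vanish, so uniform convergence on that set is
  uniform convergence everywhere.
\<close>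

lemma KS_embed_sequentially_continuous:
  fixes \<Phi> :: "nat \<Rightarrow> real^'n \<Rightarrow> 'k::{real_normed_field, euclidean_space}"
  assumes conv: "tf_converges \<Phi> \<phi>"
  shows "limitin (KS_topology x t p) (\<lambda>j. KS_embed x t p (\<Phi> j)) (KS_embed x t p \<phi>) sequentially"
proof -
  interpret Metric_space "KS_space x t p :: (nat \<Rightarrow> real^'n \<Rightarrow> 'k) set set" "KS_dist x t p"
    by (rule Metric_space_KS)
  obtain K where tf: "\<And>j. \<Phi> j \<in> test_functions" "\<phi> \<in> test_functions"
    and K: "\<And>j. fsupport (\<lambda>y. \<Phi> j y - \<phi> y) \<subseteq> K"
    and "\<And>\<alpha>. uniform_limit K (\<lambda>j. mderiv \<alpha> (\<Phi> j)) (mderiv \<alpha> \<phi>) sequentially"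
    using conv unfolding tf_converges_def by blast
  then have unif: "uniform_limit K \<Phi> \<phi> sequentially" by (metis mderiv.simps(1) ext)
  have "\<forall>\<^sub>F j in sequentially. pdist (\<Phi> j) \<phi> < e" if e: "0 < e" for e
    using uniform_limitD[OF unif half_gt_zero[OF e]]
  proof eventually_elim
    case (elim j)
    have "norm (\<Phi> j y - \<phi> y) \<le> e / 2" for y
    proof (cases "y \<in> K")
      case True
      then show ?thesis using elim by (simp add: dist_norm less_imp_le)
    next
      case False
      then have "\<Phi> j y - \<phi> y = 0" using K[of j] not_in_fsupport[of y] by blast
      then show ?thesis using e by simp
    qed
    then have "pdist (\<Phi> j) \<phi> \<le> e / 2" by (rule pdist_le_sup)
    then show ?case using e by simp
  qed
  then show ?thesis
    unfolding KS_topology_def limitin_metric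
    using tf by (simp add: KS_embed_in_space KS_dist_embed test_functions_Lp)
qed

end

theorem theorem3p9:
  fixes x :: "nat \<Rightarrow> real^'n" and t :: "nat \<Rightarrow> real" and p :: ennreal
  assumes "range x = {q. \<forall>i. q $ i \<in> \<rat>}"
    and "\<And>k. 0 < t k" and "t sums 1"
    and "1 \<le> p"
  shows "(test_functions :: (real^'n \<Rightarrow> 'k::{real_normed_field, euclidean_space}) set) \<subseteq> Lp p
    \<and> KS_embed x t p ` test_functions \<subseteq> (KS_space x t p :: (nat \<Rightarrow> real^'n \<Rightarrow> 'k) set set)
    \<and> inj_on (KS_embed x t p :: (real^'n \<Rightarrow> 'k) \<Rightarrow> _) test_functions
    \<and> (\<forall>f\<in>test_functions. \<forall>g\<in>test_functions. KS_embed x t p (\<lambda>y. f y + g y :: 'k)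
                    = KS_add x t p (KS_embed x t p f) (KS_embed x t p g))
    \<and> (\<forall>c::'k. \<forall>f\<in>test_functions. KS_embed x t p (\<lambda>y. c * f y) = KS_scale x t p c (KS_embed x t p f))
    \<and> continuous_map tf_topology (KS_topology x t p)
         (KS_embed x t p :: (real^'n \<Rightarrow> 'k) \<Rightarrow> _)
    \<and> (\<forall>\<Phi> \<phi> :: real^'n \<Rightarrow> 'k. tf_converges \<Phi> \<phi> \<longrightarrow>
         limitin (KS_topology x t p) (\<lambda>j. KS_embed x t p (\<Phi> j)) (KS_embed x t p \<phi>) sequentially)"
proof -
  interpret KS_data t p x
    by unfold_locales (use assms in auto)
  show ?thesis
  proof (intro conjI ballI allI impI)
    show "(test_functions :: (real^'n \<Rightarrow> 'k) set) \<subseteq> Lp p"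
      by (rule test_functions_subset_Lp)
    show "KS_embed x t p ` test_functions \<subseteq> (KS_space x t p :: (nat \<Rightarrow> real^'n \<Rightarrow> 'k) set set)"
      by (auto intro: KS_embed_in_space test_functions_Lp)
    show "inj_on (KS_embed x t p :: (real^'n \<Rightarrow> 'k) \<Rightarrow> _) test_functions"
      by (intro inj_onI KS_embed_eq_continuous test_functions_Lp test_function_continuous)
  qed (simp_all add: KS_embed_add KS_embed_scale test_functions_Lp KS_embed_continuous_map
      KS_embed_sequentially_continuous)
qed

end
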